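(* Let $k,m$ be positive integers with $\nu_3(k)\leq\nu_3(m)$, let $q=2^m$, let $s>1$ be a positive integer, and let $a\in\mu_{q^2+q+1}=\{x\in\mathbb{F}_{q^3}: x^{q^2+q+1}=1\}$. Let $$f_1(X)=(a+a^{2^k})X^q+\left(a^{1+q^2}+a^{2^k(1+q^2)}\right)X+\mathrm{Tr}_m^{3m}(X)^s\in\mathbb{F}_{q^3}[X].$$ Then: (1) if $q\equiv 2\pmod 3$, $f_1(X)$ is a permutation polynomial of $\mathbb{F}_{q^3}$ if and only if $a\neq 1$ and $\gcd(s,q-1)=1$; (2) if $q\equiv 1\pmod 3$ and $k$ is odd, $f_1(X)$ is a permutation polynomial of $\mathbb{F}_{q^3}$ if and only if $a\neq 1$ and $\gcd(s,q-1)=1$.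
   Context: $\nu_3(n)$ denotes the $3$-adic valuation of an integer $n$ (the largest $e$ with $3^e\mid n$). $\mathrm{Tr}_m^{3m}(X)=X+X^q+X^{q^2}$ is the relative trace from $\mathbb{F}_{q^3}$ to $\mathbb{F}_q$, $q=p^m$. A polynomial $f\in\mathbb{F}_{q^3}[X]$ is a permutation polynomial of $\mathbb{F}_{q^3}$ if $c\mapsto f(c)$ is a bijection of $\mathbb{F}_{q^3}$. *)

theory Defs
  imports
    "HOL-Computational_Algebra.Computational_Algebra"
    "HOL-Library.Cardinality"
begin

definition permutation_poly :: "'a::{field,finite} poly \<Rightarrow> bool" where
  "permutation_poly f \<longleftrightarrow> bij (\<lambda>c. poly f c)"

definition unity_roots :: "nat \<Rightarrow> 'a::field set" where
  "unity_roots d = {x. x ^ d = 1}"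

(* The relative trace from the field with q^3 elements to the field with q elements,
   as a polynomial; it has this meaning when the coefficient type has q^3 elements. *)
definition trace_poly :: "nat \<Rightarrow> 'a::field poly" where
  "trace_poly q = monom 1 1 + monom 1 q + monom 1 (q\<^sup>2)"

definition f1 :: "nat \<Rightarrow> nat \<Rightarrow> nat \<Rightarrow> 'a::field \<Rightarrow> 'a poly" where
  "f1 q k s a =
     monom (a + a ^ (2 ^ k)) q
     + monom (a ^ (1 + q\<^sup>2) + a ^ (2 ^ k * (1 + q\<^sup>2))) 1
     + trace_poly q ^ s"

end

theory Submission
  imports Defs
begin

text \<open>
  Write \<open>Q = 2 ^ k\<close> and \<open>F\<close> for the field with \<open>q\<close> elements. By Hilbert 90, \<open>a = b / b\<^sup>q\<close> for
  some nonzero \<open>b\<close>. Up to a constant factor the linear part of \<open>f\<^sub>1\<close> is then \<open>L(X) = D X\<^sup>q + D\<^sup>q X\<close>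
  with \<open>D = b b\<^bsup>qQ\<^esup> + b\<^sup>q b\<^sup>Q\<close>, which has kernel \<open>F D\<close> if \<open>D \<noteq> 0\<close>, and there is an explicit \<open>c\<close>,
  conjugate to the analogue of \<open>D\<close> for \<open>1 / b\<close>, such that \<open>Tr(c y) = 0\<close> for all \<open>y\<close> in the image of
  the linear part. The assumptions on \<open>k\<close> and \<open>m\<close> guarantee that \<open>Tr D\<close> and \<open>Tr c\<close> are nonzero
  when \<open>a \<noteq> 1\<close>. Hence \<open>Tr(c f\<^sub>1(x)) = Tr(c) Tr(x)\<^sup>s\<close>: if \<open>s\<close>-th powers are injective on \<open>F\<close>, then
  \<open>f\<^sub>1(x)\<close> determines \<open>Tr x\<close> and \<open>L(x)\<close>, hence \<open>x\<close>. Conversely \<open>f\<^sub>1\<close> restricted to the kernel of the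
  linear part is \<open>Tr(x)\<^sup>s\<close>, which is injective there only if \<open>gcd(s, q - 1) = 1\<close>.
\<close>

section \<open>Power maps on finite fields, fixed points and valuations\<close>

lemma finite_field_power_card:
  fixes x :: "'a::{field,finite}"
  shows "x ^ CARD('a) = x"
proof (cases "x = 0")
  case False
  have "x * (\<Prod>y\<in>UNIV-{0}. x * y) = x * x ^ (CARD('a) - 1) * \<Prod>(UNIV-{0})"
    by (simp add: prod.distrib mult_ac)
  also have "x * x ^ (CARD('a) - 1) = x ^ CARD('a)"
    by (metis power_minus_mult mult.commute finite_UNIV_card_ge_0 finite)
  also have "(\<Prod>y\<in>UNIV-{0}. x * y) = (\<Prod>y\<in>UNIV-{0}. y)"
    by (rule prod.reindex_bij_witness[of _ "\<lambda>y. y / x" "\<lambda>y. x * y"]) (use False in auto)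
  finally show ?thesis
    by simp
qed auto

lemma of_nat_card_eq_0: "of_nat CARD('a) = (0 :: 'a::{ring_1,finite})"
proof -
  have "(\<Sum>x\<in>UNIV. x + 1) = (\<Sum>x\<in>UNIV. x :: 'a)"
    by (rule sum.reindex_bij_witness[of _ "\<lambda>y. y - 1" "\<lambda>y. y + 1"]) auto
  then show ?thesis
    by (simp add: sum.distrib)
qed

lemma exists_poly_neq_0:
  fixes p :: "'a::{field,finite} poly"
  assumes "p \<noteq> 0" and "degree p < CARD('a)"
  shows "\<exists>x. poly p x \<noteq> 0"
proof (rule ccontr)
  assume "\<nexists>x. poly p x \<noteq> 0"
  then have "{x. poly p x = 0} = UNIV" by auto
  then show False
    using card_poly_roots_bound[OF assms(1)] assms(2) by simp
qed

lemma power_fixpoint_iterate: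
  fixes x :: "'a::monoid_mult"
  assumes "x ^ (c ^ n) = x"
  shows "x ^ (c ^ (n * i)) = x"
  by (induction i) (simp_all add: power_add power_mult assms)

text \<open>Bezout over the naturals: \<open>i * u\<close> steps of the map
  \<open>x \<mapsto> x ^ c\<close> fix \<open>x\<close>, and the first \<open>j * v\<close> of them
  already do, so the remaining \<open>gcd i j\<close> steps fix \<open>x\<close> too.\<close>

lemma power_fixpoint_gcd:
  fixes x :: "'a::monoid_mult"
  assumes "x ^ (c ^ i) = x" and "x ^ (c ^ j) = x" and "i \<noteq> 0"
  shows "x ^ (c ^ gcd i j) = x"
proof -
  obtain u v where "i * u = j * v + gcd i j"
    using bezout_nat[OF assms(3)] by blast
  then have "x ^ (c ^ (j * v) * c ^ gcd i j) = x"
    using power_fixpoint_iterate[OF assms(1), of u] by (metis power_add)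
  then show ?thesis
    unfolding power_mult[of x] power_fixpoint_iterate[OF assms(2)] .
qed

text \<open>Valuations are compared prime by prime: the factor \<open>p\<close> raises only the
  valuation at \<open>p\<close>, and there \<open>k\<close> caps the gcd. With \<open>p = 3\<close>
  this is where the hypothesis on valuations enters.\<close>

lemma gcd_mult_prime_dvd:
  fixes k m p :: nat
  assumes "prime p" and "k > 0" and "m > 0" and "multiplicity p k \<le> multiplicity p m"
  shows "gcd k (p * m) dvd m"
proof (rule multiplicity_le_imp_dvd)
  fix r :: nat
  assume r: "prime r"
  show "multiplicity r (gcd k (p * m)) \<le> multiplicity r m"
  proof (cases "r = p")
    case True
    have "multiplicity p (gcd k (p * m)) \<le> multiplicity p k"
      using assms by (intro dvd_imp_multiplicity_le) auto
    with True assms(4) show ?thesis by simp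
  next
    case False
    then have "\<not> r dvd p"
      using r assms(1) primes_dvd_imp_eq by blast
    then have "multiplicity r (p * m) = multiplicity r m"
      using r by (simp add: multiplicity_prime_elem_times_other)
    moreover have "multiplicity r (gcd k (p * m)) \<le> multiplicity r (p * m)"
      using assms by (intro dvd_imp_multiplicity_le) (auto simp: prime_gt_0_nat)
    ultimately show ?thesis by simp
  qed
qed (use assms in auto)

lemma power_coprime_eq_1:
  fixes x :: "'a::monoid_mult"
  assumes "x ^ i = 1" and "x ^ j = 1" and "coprime i j" and "i \<noteq> 0"
  shows "x = 1"
proof -
  obtain u v where "i * u = j * v + 1"
    using bezout_nat[OF assms(4), of j] assms(3) by auto
  then have "x ^ (i * u) = x ^ (j * v + 1)" by simp
  then show ?thesis
    by (simp add: power_mult assms(1,2))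
qed

lemma odd_power_2_mod_3: "odd k \<Longrightarrow> (2::nat) ^ k mod 3 = 2"
proof -
  assume "odd k"
  then obtain j where "k = 2 * j + 1" by (auto elim: oddE)
  moreover have "(4::nat) ^ j mod 3 = 1"
    by (induction j) (simp_all, presburger)
  ultimately show ?thesis
    by (simp add: power_mult) presburger
qed

section \<open>Characteristic 2, Frobenius and the relative trace\<close>

locale char2_cubic_extension =
  fixes m q :: nat and type :: "'a::{field,finite} itself"
  assumes m_pos: "m > 0"
    and q_def: "q = 2 ^ m"
    and card: "CARD('a) = q ^ 3"
begin

lemma q_gt_1: "q > 1"
  using m_pos one_less_power[of "2::nat" m] by (simp add: q_def)

lemma q_lt_q3: "q < q ^ 3" and q2_lt_q3: "q ^ 2 < q ^ 3"
  using power_strict_increasing[of 1 3 q] power_strict_increasing[of 2 3 q] q_gt_1 by auto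

lemma two_eq_0: "(2 :: 'a) = 0"
proof -
  have "of_nat (2 ^ (m * 3)) = (0 :: 'a)"
    using of_nat_card_eq_0[where 'a='a] by (simp add: card q_def power_mult)
  then show ?thesis by simp
qed

lemma CHAR_2: "CHAR('a) = 2"
proof -
  have "CHAR('a) dvd 2"
    using two_eq_0 by (metis of_nat_eq_0_iff_char_dvd of_nat_numeral)
  then show ?thesis
    by (metis CHAR_not_1' One_nat_def prime_nat_iff two_is_prime_nat)
qed

lemma add_self [simp]: "(x :: 'a) + x = 0"
  using two_eq_0 by (simp flip: mult_2)

lemma minus_eq: "(x :: 'a) - y = x + y"
  by (simp add: minus_CHAR_2[OF CHAR_2])

lemma add_eq_0: "(x :: 'a) + y = 0 \<longleftrightarrow> x = y"
  using minus_eq[of x y] by (metis right_minus_eq)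

lemma frob_add: "(x + y :: 'a) ^ (2 ^ n) = x ^ (2 ^ n) + y ^ (2 ^ n)"
  by (rule freshmans_dream') (simp_all add: CHAR_2)

lemma frob_q_add: "(x + y :: 'a) ^ q = x ^ q + y ^ q"
  by (simp add: q_def frob_add)

lemma frob_q_cube: "((x ^ q) ^ q) ^ q = (x :: 'a)"
  using finite_field_power_card[of x] by (simp add: card power3_eq_cube power_mult)

lemmas frob_simps = frob_q_add power_mult_distrib frob_q_cube

definition tr :: "'a \<Rightarrow> 'a" where
  "tr x = x + x ^ q + (x ^ q) ^ q"

lemma tr_in_base: "tr x ^ q = tr x"
  by (simp add: tr_def frob_simps)

lemma tr_add: "tr (x + y) = tr x + tr y"
  by (simp add: tr_def frob_simps)

lemma tr_scale: "c ^ q = c \<Longrightarrow> tr (c * x) = c * tr x"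
  by (simp add: tr_def frob_simps algebra_simps)

lemma tr_frob: "tr (x ^ q) = tr x"
  by (simp add: tr_def frob_simps)

section \<open>Hilbert 90 and elements found by counting roots\<close>

lemma hilbert90:
  fixes a :: 'a
  assumes "a ^ (q\<^sup>2 + q + 1) = 1"
  obtains b where "b \<noteq> 0" and "a * b ^ q = b"
proof -
  \<comment> \<open>Lagrange resolvent of \<open>a\<close>: any nonzero value \<open>b\<close>
    works, since the norm condition \<open>N\<close> closes the cycle. Its degree is below the field
    size, so a nonroot exists.\<close>
  define p where "p = monom 1 1 + monom a q + monom (a * a ^ q) (q ^ 2)"
  have "q ^ 2 \<noteq> 1"
    using q_gt_1 by (simp add: power2_eq_square)
  then have "coeff p 1 = 1"
    using q_gt_1 by (simp add: p_def)
  then have "p \<noteq> 0" by auto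
  have "q \<le> q ^ 2"
    using q_gt_1 by (simp add: power2_eq_square)
  have "degree p \<le> q ^ 2"
    unfolding p_def
    using \<open>q \<le> q ^ 2\<close> q_gt_1
    by (intro degree_add_le order.trans[OF degree_monom_le]) auto
  then obtain y where y: "poly p y \<noteq> 0"
    using exists_poly_neq_0[OF \<open>p \<noteq> 0\<close>] q2_lt_q3 card by auto
  define b where "b = y + a * y ^ q + a * a ^ q * (y ^ q) ^ q"
  have N: "a * (a ^ q * (a ^ q) ^ q) = 1"
    using assms by (simp add: power_add power_mult power2_eq_square mult_ac)
  have "a * b ^ q = a * y ^ q + a * a ^ q * (y ^ q) ^ q + a * (a ^ q * (a ^ q) ^ q) * y"
    by (simp add: b_def frob_simps algebra_simps)
  then have "a * b ^ q = b"
    by (simp add: N b_def algebra_simps)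
  moreover have "b \<noteq> 0"
    using y by (simp add: p_def b_def poly_monom power2_eq_square power_mult)
  ultimately show thesis
    using that by blast
qed

lemma frob_not_identity: "\<exists>z :: 'a. z ^ q \<noteq> z"
proof -
  define p where "p = monom 1 q - monom (1 :: 'a) 1"
  have "coeff p q = 1"
    using q_gt_1 by (simp add: p_def)
  then have "p \<noteq> 0" by auto
  have "degree p \<le> q"
    unfolding p_def
    using q_gt_1 by (intro degree_diff_le order.trans[OF degree_monom_le]) auto
  then obtain z where "poly p z \<noteq> 0"
    using exists_poly_neq_0[OF \<open>p \<noteq> 0\<close>] q_lt_q3 card by auto
  then show ?thesis
    by (auto simp: p_def poly_monom)
qed

lemma exists_root_of_unity:
  assumes "d dvd q - 1" and "d > 1"
  obtains z :: 'a where "z \<noteq> 1" and "z ^ d = 1"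
proof -
  obtain e where e: "q - 1 = d * e"
    using assms(1) by blast
  define n where "n = e * (q ^ 2 + q + 1)"
  have "e > 0"
    using e q_gt_1 by (cases e) auto
  have "q ^ 3 - 1 = (q - 1) * (q ^ 2 + q + 1)"
    using q_gt_1 by (cases q) (auto simp: power3_eq_cube power2_eq_square algebra_simps)
  then have dn: "d * n = q ^ 3 - 1"
    by (metis n_def e mult.assoc)
  have "n > 0"
    using \<open>e > 0\<close> by (simp add: n_def)
  then have "n < d * n"
    using assms(2) by simp
  \<comment> \<open>The exponent \<open>Suc n\<close> instead of \<open>n\<close> adds a factor X,
    so that a nonroot is also nonzero; the degree is still at most \<open>q ^ 3 - 1\<close>.\<close>
  define p where "p = monom 1 (Suc n) - monom (1 :: 'a) 1"
  have "coeff p (Suc n) = 1"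
    using \<open>n > 0\<close> by (simp add: p_def)
  then have "p \<noteq> 0" by auto
  have "degree p \<le> Suc n"
    unfolding p_def
    by (intro degree_diff_le order.trans[OF degree_monom_le]) auto
  then obtain x where "poly p x \<noteq> 0"
    using exists_poly_neq_0[OF \<open>p \<noteq> 0\<close>] \<open>n < d * n\<close> dn card by fastforce
  then have x: "x \<noteq> 0" "x ^ n \<noteq> 1"
    by (auto simp: p_def poly_monom)
  have "x * x ^ (q ^ 3 - 1) = x"
    using finite_field_power_card[of x] q_gt_1
    by (metis card power_eq_if finite_UNIV_card_ge_0 finite less_numeral_extra(3))
  then have "(x ^ n) ^ d = 1"
    using x by (simp add: dn mult.commute flip: power_mult)
  then show thesis
    using that x by blast
qed

section \<open>Nonvanishing of the trace of the wedge\<close>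

text \<open>
  For \<open>Q = 2 ^ k\<close> the trace of \<open>b b\<^bsup>qQ\<^esup> + b\<^sup>q b\<^sup>Q\<close> is the determinant of the rows
  \<open>(1, 1, 1)\<close>, \<open>(b, b\<^sup>q, b\<^bsup>qq\<^esup>)\<close> and the \<open>Q\<close>-th powers of the latter; subtracting the first
  column reduces it to \<open>u v\<^sup>Q + v u\<^sup>Q\<close>, so it vanishes only if \<open>u / v\<close> is fixed by
  \<open>x \<mapsto> x\<^sup>Q\<close>; here \<open>u = b + b\<^sup>q\<close> and \<open>v = b + b\<^bsup>qq\<^esup>\<close>.
\<close>

definition wedge :: "nat \<Rightarrow> 'a \<Rightarrow> 'a" where
  "wedge k b = b * (b ^ q) ^ (2 ^ k) + b ^ q * b ^ (2 ^ k)"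

lemma tr_wedge_neq_0:
  fixes b :: 'a
  assumes "k > 0" and "multiplicity 3 k \<le> multiplicity 3 m"
    and "q mod 3 = 2 \<or> odd k"
    and "b ^ q \<noteq> b"
  shows "tr (wedge k b) \<noteq> 0"
proof
  assume tr0: "tr (wedge k b) = 0"
  define Q :: nat where "Q = 2 ^ k"
  have Qadd: "(x + y) ^ Q = x ^ Q + y ^ Q" for x y :: 'a
    by (simp add: Q_def frob_add)
  define u where "u = b + b ^ q"
  define v where "v = b + (b ^ q) ^ q"
  have "u \<noteq> 0"
    using assms(4) by (metis u_def add_eq_0)
  have "v \<noteq> 0"
    using assms(4) frob_q_cube[of b] by (metis v_def add_eq_0)
  have comm: "(x ^ Q) ^ q = (x ^ q) ^ Q" for x :: 'a
    by (simp add: mult.commute flip: power_mult)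
  have "tr (wedge k b) = u * v ^ Q + v * u ^ Q"
    unfolding tr_def wedge_def u_def v_def Q_def[symmetric]
    by (simp add: frob_simps Qadd comm algebra_simps two_eq_0)
  then have "u * v ^ Q = v * u ^ Q"
    using tr0 add_eq_0 by metis
  define l where "l = u / v"
  have lQ: "l ^ Q = l"
    using \<open>u * v ^ Q = v * u ^ Q\<close> \<open>v \<noteq> 0\<close> by (simp add: l_def field_simps)
  \<comment> \<open>Being fixed by the powers \<open>2 ^ k\<close> and \<open>2 ^ (3 * m)\<close>,
    \<open>l\<close> is fixed by \<open>2 ^ gcd k (3 * m)\<close>; this gcd divides
    \<open>m\<close>, so \<open>l\<close> lies in \<open>F\<close>.\<close>
  have "l ^ (2 ^ (3 * m)) = l"
    using finite_field_power_card[of l] by (simp add: card q_def mult.commute flip: power_mult)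
  then have "l ^ (2 ^ gcd k (3 * m)) = l"
    using lQ assms(1) by (intro power_fixpoint_gcd) (simp_all add: Q_def)
  moreover obtain i where "m = gcd k (3 * m) * i"
    using gcd_mult_prime_dvd[of 3 k m] assms(1,2) m_pos by (auto elim: dvdE)
  ultimately have lq: "l ^ q = l"
    unfolding q_def by (metis power_fixpoint_iterate)
  \<comment> \<open>Taking \<open>q\<close>-th powers in \<open>l = u / v\<close> gives
    \<open>l = 1 + 1 / l\<close>.\<close>
  have "u ^ q = u + v" and "v ^ q = u"
    by (simp_all add: u_def v_def frob_simps algebra_simps two_eq_0)
  then have "(u + v) / u = u / v"
    using lq by (simp add: l_def power_divide)
  then have l2: "l\<^sup>2 = l + 1"
    using \<open>u \<noteq> 0\<close> \<open>v \<noteq> 0\<close> by (simp add: l_def power2_eq_square field_simps)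
  have "l ^ 3 = l + (l + 1)"
    using l2 by (simp add: power3_eq_cube power2_eq_square algebra_simps)
  then have l3: "l ^ 3 = 1"
    by (simp add: add.assoc[symmetric])
  \<comment> \<open>\<open>l\<close> is a primitive cube root of unity. Both \<open>q\<close> and
    \<open>2 ^ k\<close> fix it, and one of them is 2 mod 3, which would force
    \<open>l = l ^ 2 = l + 1\<close>.\<close>
  obtain n where n: "n mod 3 = 2" "l ^ n = l"
    using assms(3) lq lQ odd_power_2_mod_3[of k] by (auto simp: Q_def)
  have "n = 3 * (n div 3) + 2"
    using n(1) by presburger
  then have "l ^ n = l\<^sup>2"
    by (metis l3 mult_1 power_add power_mult power_one)
  with n(2) l2 show False by simp
qed

section \<open>The linear part and its annihilator\<close>

lemma poly_f1:
  "poly (f1 q k s a) (x :: 'a)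
    = (a + a ^ (2 ^ k)) * x ^ q + (a * (a ^ q) ^ q + (a * (a ^ q) ^ q) ^ (2 ^ k)) * x + tr x ^ s"
proof -
  have "a ^ (2 ^ k * (1 + q\<^sup>2)) = (a ^ (1 + q\<^sup>2)) ^ (2 ^ k)"
    by (metis mult.commute power_mult)
  moreover have "a ^ (1 + q\<^sup>2) = a * (a ^ q) ^ q"
    by (simp add: power2_eq_square power_mult)
  ultimately show ?thesis
    by (simp add: f1_def trace_poly_def poly_monom tr_def power2_eq_square power_mult)
qed

text \<open>For \<open>a = 1\<close> the linear part vanishes, and a power of the trace takes values
  in \<open>F\<close> only.\<close>

lemma permutation_poly_f1_imp_neq_1:
  assumes "permutation_poly (f1 q k s (a :: 'a))"
  shows "a \<noteq> 1"
proof
  assume "a = 1"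
  then have f: "poly (f1 q k s a) x = tr x ^ s" for x
    by (simp add: poly_f1)
  obtain z :: 'a where z: "z ^ q \<noteq> z"
    using frob_not_identity by blast
  obtain x where "z = tr x ^ s"
    using assms f unfolding permutation_poly_def bij_def surj_def by metis
  then have "z ^ q = z"
    by (metis mult.commute power_mult tr_in_base)
  with z show False by simp
qed

text \<open>The factor clears denominators: \<open>b^q * a = b\<close> and
  \<open>b^q * a^(1+q^2) = b^(q^2)\<close>.\<close>

lemma linear_part:
  fixes a b x :: 'a
  assumes "a * b ^ q = b"
  shows "(b ^ q) ^ (1 + 2 ^ k) *
      ((a + a ^ (2 ^ k)) * x ^ q + (a * (a ^ q) ^ q + (a * (a ^ q) ^ q) ^ (2 ^ k)) * x)
    = wedge k b * x ^ q + wedge k b ^ q * x"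
proof -
  define Q :: nat where "Q = 2 ^ k"
  have comm: "(x ^ Q) ^ q = (x ^ q) ^ Q" for x :: 'a
    by (simp add: mult.commute flip: power_mult)
  have 1: "b ^ q * a = b"
    using assms by (simp add: mult.commute)
  have "(a ^ q) ^ q * b = (b ^ q) ^ q"
    using arg_cong[OF assms, of "\<lambda>x. (x ^ q) ^ q"] by (simp add: frob_simps)
  then have 2: "b ^ q * (a * (a ^ q) ^ q) = (b ^ q) ^ q"
    using 1 by (metis mult.assoc mult.commute)
  have 3: "(b ^ q) ^ Q * a ^ Q = b ^ Q"
    using 1 by (metis power_mult_distrib)
  have 4: "(b ^ q) ^ Q * (a * (a ^ q) ^ q) ^ Q = ((b ^ q) ^ q) ^ Q"
    using 2 by (metis power_mult_distrib)
  define r where "r = b ^ q"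
  define t where "t = a * (a ^ q) ^ q"
  have "r ^ (1 + Q) * ((a + a ^ Q) * x ^ q + (t + t ^ Q) * x)
    = ((r * a) * r ^ Q + r * (r ^ Q * a ^ Q)) * x ^ q + ((r * t) * r ^ Q + r * (r ^ Q * t ^ Q)) * x"
    by (simp add: algebra_simps)
  also have "\<dots> = wedge k b * x ^ q + wedge k b ^ q * x"
    using 1 2 3 4
    by (simp add: r_def t_def wedge_def Q_def[symmetric] frob_simps comm algebra_simps)
  finally show ?thesis
    by (simp add: r_def t_def Q_def)
qed

text \<open>Clearing denominators interchanges the two summands of the wedge.\<close>

lemma wedge_inverse:
  fixes b :: 'a
  assumes "b \<noteq> 0"
  shows "(b * b ^ q) ^ (1 + 2 ^ k) * wedge k (inverse b) = wedge k b"
  using assms by (simp add: wedge_def field_simps flip: power_mult)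

text \<open>Scaling by \<open>M\<close>, a power of the norm of \<open>b\<close> and hence in
  \<open>F\<close>, turns the argument of the trace into
  \<open>D^(q^2) * (D * x^q + D^q * x)\<close>. In its trace every term occurs twice.\<close>

lemma tr_annihilator:
  fixes b x :: 'a
  assumes "b \<noteq> 0"
    and L: "(b ^ q) ^ (1 + 2 ^ k) * y = wedge k b * x ^ q + wedge k b ^ q * x"
  shows "tr (((wedge k (inverse b)) ^ q) ^ q * y) = 0"
proof -
  define D where "D = wedge k b"
  define M where "M = (b * b ^ q * (b ^ q) ^ q) ^ (1 + 2 ^ k)"
  have comm: "(x ^ (1 + 2 ^ k)) ^ q = (x ^ q) ^ (1 + 2 ^ k)" for x :: 'a
    by (simp only: mult.commute flip: power_mult)
  have "M ^ q = M"
    unfolding M_def comm by (simp add: frob_simps mult_ac)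
  have "M \<noteq> 0"
    using assms(1) by (simp add: M_def)
  have "((b ^ q) ^ q * b) ^ (1 + 2 ^ k) * ((wedge k (inverse b)) ^ q) ^ q = (D ^ q) ^ q"
    unfolding D_def wedge_inverse[OF assms(1), symmetric]
    by (simp only: power_mult_distrib comm frob_q_cube)
  then have C_eq: "((b ^ q) ^ q * b) ^ (1 + 2 ^ k) * (((wedge k (inverse b)) ^ q) ^ q * z)
      = (D ^ q) ^ q * z" for z
    by (simp only: mult.assoc[symmetric])
  have M_eq: "M = ((b ^ q) ^ q * b) ^ (1 + 2 ^ k) * (b ^ q) ^ (1 + 2 ^ k)"
    unfolding M_def by (simp only: flip: power_mult_distrib) (simp add: mult_ac)
  have "M * (((wedge k (inverse b)) ^ q) ^ q * y)
      = (D ^ q) ^ q * ((b ^ q) ^ (1 + 2 ^ k) * y)"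
    unfolding M_eq C_eq[symmetric] by (simp only: mult_ac)
  also have "\<dots> = (D ^ q) ^ q * (D * x ^ q + D ^ q * x)"
    by (simp only: L D_def)
  finally have "M * tr (((wedge k (inverse b)) ^ q) ^ q * y)
      = tr ((D ^ q) ^ q * (D * x ^ q + D ^ q * x))"
    using tr_scale[OF \<open>M ^ q = M\<close>] by metis
  also have "\<dots> = 2 * (D * D ^ q * (x ^ q) ^ q + D * (D ^ q) ^ q * x ^ q + D ^ q * (D ^ q) ^ q * x)"
    by (simp add: tr_def frob_simps algebra_simps)
  finally show ?thesis
    using \<open>M \<noteq> 0\<close> two_eq_0 by simp
qed

section \<open>The permutation criterion\<close>

lemma base_power_inj:
  fixes x y :: 'a
  assumes "x ^ q = x" and "y ^ q = y" and "x ^ s = y ^ s" and "coprime s (q - 1)" and "s > 0"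
  shows "x = y"
proof (cases "x = 0 \<or> y = 0")
  case True
  then show ?thesis
    using assms(3,5) by (auto simp: power_0_left)
next
  case False
  have "z ^ (q - 1) = 1" if "z ^ q = z" "z \<noteq> 0" for z :: 'a
    using that q_gt_1 by (simp add: power_eq_if)
  then have "(x / y) ^ (q - 1) = 1"
    using assms(1,2) False by (simp add: power_divide)
  moreover have "(x / y) ^ s = 1"
    using assms(3) False by (simp add: power_divide)
  ultimately have "x / y = 1"
    using power_coprime_eq_1 assms(4,5) by blast
  then show ?thesis
    using False by simp
qed

theorem permutation_poly_f1_iff:
  fixes a :: 'a
  assumes "k > 0" and "multiplicity 3 k \<le> multiplicity 3 m"
    and "q mod 3 = 2 \<or> odd k" and "s > 0" and "a ^ (q\<^sup>2 + q + 1) = 1"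
  shows "permutation_poly (f1 q k s a) \<longleftrightarrow> a \<noteq> 1 \<and> gcd s (q - 1) = 1"
proof (cases "a = 1")
  case True
  then show ?thesis
    using permutation_poly_f1_imp_neq_1 by auto
next
  case False
  obtain b where b: "b \<noteq> 0" "a * b ^ q = b"
    using hilbert90[OF assms(5)] by blast
  have "b ^ q \<noteq> b"
    using b False by auto
  then have "inverse b ^ q \<noteq> inverse b"
    using b(1) by (simp add: power_inverse)
  define D where "D = wedge k b"
  define c where "c = ((wedge k (inverse b)) ^ q) ^ q"
  have trD: "tr D \<noteq> 0"
    unfolding D_def using tr_wedge_neq_0 assms \<open>b ^ q \<noteq> b\<close> by blast
  have trc: "tr c \<noteq> 0"
    unfolding c_def tr_frob using tr_wedge_neq_0 assms \<open>inverse b ^ q \<noteq> inverse b\<close> by blast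
  have "D \<noteq> 0"
    using trD q_gt_1 by (auto simp: tr_def power_0_left)
  define L where
    "L x = (a + a ^ (2 ^ k)) * x ^ q + (a * (a ^ q) ^ q + (a * (a ^ q) ^ q) ^ (2 ^ k)) * x" for x
  have f: "poly (f1 q k s a) x = L x + tr x ^ s" for x
    by (simp add: poly_f1 L_def)
  have wL: "(b ^ q) ^ (1 + 2 ^ k) * L x = D * x ^ q + D ^ q * x" for x
    unfolding L_def D_def by (rule linear_part[OF b(2)])
  have L_add: "L (x + y) = L x + L y" for x y
    by (simp add: L_def frob_simps algebra_simps)
  have L_eq_0: "L x = 0 \<longleftrightarrow> D * x ^ q = D ^ q * x" for x
  proof -
    have "L x = 0 \<longleftrightarrow> (b ^ q) ^ (1 + 2 ^ k) * L x = 0"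
      using b(1) by simp
    then show ?thesis
      by (simp only: wL add_eq_0)
  qed
  have annih: "tr (c * L x) = 0" for x
    unfolding c_def using tr_annihilator[OF b(1)] wL D_def by blast
  show ?thesis
  proof (intro iffI conjI False)
    assume perm: "permutation_poly (f1 q k s a)"
    show "gcd s (q - 1) = 1"
    proof (rule ccontr)
      assume "gcd s (q - 1) \<noteq> 1"
      moreover have "gcd s (q - 1) > 0"
        using assms(4) by simp
      ultimately have "gcd s (q - 1) > 1"
        by linarith
      then obtain z :: 'a where z: "z \<noteq> 1" "z ^ gcd s (q - 1) = 1"
        using exists_root_of_unity[of "gcd s (q - 1)"] by blast
      have z1: "z ^ n = 1" if "gcd s (q - 1) dvd n" for n
        using that z(2) by (auto elim!: dvdE simp: power_mult)
      have "z ^ s = 1" and "z ^ (q - 1) = 1"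
        by (simp_all add: z1)
      then have "z ^ q = z"
        using q_gt_1 by (simp add: power_eq_if)
      \<comment> \<open>\<open>D\<close> and \<open>z * D\<close> both lie in the kernel, and their
        traces differ by the factor \<open>z\<close>, which the \<open>s\<close>-th power
        removes.\<close>
      then have "L D = 0" and "L (z * D) = 0"
        by (simp_all add: L_eq_0 power_mult_distrib)
      then have "poly (f1 q k s a) (z * D) = poly (f1 q k s a) D"
        by (simp add: f tr_scale \<open>z ^ q = z\<close> power_mult_distrib \<open>z ^ s = 1\<close>)
      then have "z * D = D"
        using perm unfolding permutation_poly_def bij_def inj_def by blast
      then show False
        using z(1) \<open>D \<noteq> 0\<close> by simp
    qed
  next
    assume "a \<noteq> 1 \<and> gcd s (q - 1) = 1"
    then have coprime: "coprime s (q - 1)"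
      by (simp add: coprime_iff_gcd_eq_1)
    have "inj (\<lambda>x. poly (f1 q k s a) x)"
    proof (rule injI)
      fix x y
      assume eq: "poly (f1 q k s a) x = poly (f1 q k s a) y"
      have "tr (c * poly (f1 q k s a) x) = tr x ^ s * tr c" for x
      proof -
        have "(tr x ^ s) ^ q = tr x ^ s"
          by (metis mult.commute power_mult tr_in_base)
        then have "tr (tr x ^ s * c) = tr x ^ s * tr c"
          by (rule tr_scale)
        then show ?thesis
          by (simp add: f distrib_left tr_add annih mult.commute)
      qed
      then have "tr x ^ s = tr y ^ s"
        using eq trc by (metis mult_right_cancel)
      then have "tr x = tr y"
        using base_power_inj tr_in_base coprime assms(4) by blast
      then have "tr (x + y) = 0" and "L (x + y) = 0"
        using eq by (simp_all add: f tr_add L_add)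
      \<comment> \<open>The kernel is \<open>F D\<close>, so \<open>x + y = l * D\<close> with
        \<open>l\<close> in \<open>F\<close>, and its trace \<open>l * tr D\<close> is zero only for
        \<open>l = 0\<close>.\<close>
      define l where "l = (x + y) / D"
      have "l ^ q = l"
        using \<open>L (x + y) = 0\<close> \<open>D \<noteq> 0\<close> by (simp add: L_eq_0 l_def power_divide field_simps)
      moreover have "l * D = x + y"
        using \<open>D \<noteq> 0\<close> by (simp add: l_def)
      ultimately have "l = 0"
        using \<open>tr (x + y) = 0\<close> trD tr_scale by (metis mult_eq_0_iff)
      then have "x + y = 0"
        using \<open>l * D = x + y\<close> by simp
      then show "x = y"
        by (simp add: add_eq_0)
    qed
    then show "permutation_poly (f1 q k s a)"
      unfolding permutation_poly_def by (simp add: bij_def finite_UNIV_inj_surj)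
  qed
qed

end

theorem theorem3p1:
  fixes k m q s :: nat
    and a :: "'a::{field,finite}"
  assumes "k > 0" and "m > 0"
    and "multiplicity 3 k \<le> multiplicity 3 m"
    and "q = 2 ^ m"
    and "CARD('a) = q ^ 3"
    and "s > 1"
    and "a \<in> unity_roots (q\<^sup>2 + q + 1)"
  shows "(q mod 3 = 2 \<longrightarrow>
            (permutation_poly (f1 q k s a) \<longleftrightarrow> a \<noteq> 1 \<and> gcd s (q - 1) = 1)) \<and>
         (q mod 3 = 1 \<and> odd k \<longrightarrow>
            (permutation_poly (f1 q k s a) \<longleftrightarrow> a \<noteq> 1 \<and> gcd s (q - 1) = 1))"
proof -
  interpret char2_cubic_extension m q "TYPE('a)"
    using assms by unfold_locales auto
  have "a ^ (q\<^sup>2 + q + 1) = 1"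
    using assms(7) by (simp add: unity_roots_def)
  then show ?thesis
    using permutation_poly_f1_iff[of k s a] assms(1,3,6) by auto
qed

end
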